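(* Let $s\in\mathbb{R}_{>0}$, let $v\in\mathbb{R}^{d+1}$ with $\|v\|=1$, $v_{d+1}\neq 0$ and $v\neq(0,\ldots,0,\pm1)$, and let $p\in\mathbb{R}^{d+1}$ with $\|p\|=1$ and $b\in[0,1)$ be such that $b+\langle p,v\rangle>0$. Then the image under $S^{-1}(\cdot,v,s)$ of the hyperspherical cap $C(p,b)$ is a hyperellipsoid in $\mathbb{R}^d$. The center of the hyperellipsoid is $$c=S^{-1}\left(\frac{p-\alpha v}{\|p-\alpha v\|},v,s\right),\qquad\text{where }\alpha:=\frac{1-b^2}{2(b+\langle p,v\rangle)}.$$ The smallest radius (semi-axis length) and the corresponding direction are $$r_1=s\sqrt{\frac{(1-b^2)v_{d+1}^2}{(b+\langle p,v\rangle)^2}}=s\sqrt{\frac{1-b^2}{(b+\langle p,v\rangle)^2}}\,|v_{d+1}|,\qquad a_1=\frac{v_{1,\ldots,d}}{\|v_{1,\ldots,d}\|},$$ and the radius in all directions $a_2$ orthogonal to $a_1$ is $$r_2=s\sqrt{\frac{1-b^2}{(b+\langle p,v\rangle)^2}}.$$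
   Context: $\|\cdot\|$ is the Euclidean norm and $\langle\cdot,\cdot\rangle$ the standard inner product. For $z\in\mathbb{R}^{d+1}$, $z_{1,\ldots,d}\in\mathbb{R}^d$ denotes its first $d$ coordinates and $z_{d+1}$ its last coordinate. $\mathcal{S}_d=\{x\in\mathbb{R}^{d+1}:\|x\|=1\}$. For a unit vector $v\in\mathbb{R}^{d+1}$ and $s>0$, the unembedding map is defined for $Y\in\mathcal{S}_d\setminus\{-v\}$ by $$S^{-1}(Y,v,s)=2s\left(\frac{Y+v}{\|Y+v\|^2}\right)_{1,\ldots,d}\in\mathbb{R}^d.$$ When $v_{d+1}\ne0$ it is the inverse of the embedding $S(x,v,s)=2s\frac{h(x)}{\|h(x)\|^2}-v$, $x\in\mathbb{R}^d$, where $h(x)=\left[x,\frac{s-\langle x,v_{1,\ldots,d}\rangle}{v_{d+1}}\right]\in\mathbb{R}^{d+1}$ is $x$ extended by the indicated last coordinate (so $\langle h(x),v\rangle=s$). The (open) hyperspherical cap with unit direction $p\in\mathcal{S}_d$ and bias $b$ is $C(p,b)=\{x\in\mathcal{S}_d:\langle x,p\rangle>b\}$. A hyperellipsoid is meant as a solid (open) region: with center $c$, radius $r_1$ in the unit direction $a_1$ and radius $r_2$ in all directions orthogonal to $a_1$, it is the set of $y\in\mathbb{R}^d$ with $$\frac{\langle y-c,a_1\rangle^2}{r_1^2}+\frac{\|y-c-\langle y-c,a_1\rangle a_1\|^2}{r_2^2}<1.$$ *)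

theory Defs
  imports "HOL-Analysis.Analysis"
begin

text \<open>
  The space of dimension \<open>d + 1\<close> is represented as the product \<open>(real ^ 'd) \<times> real\<close> with
  \<open>d = CARD('d)\<close>: \<^const>\<open>fst\<close> gives the first \<open>d\<close> coordinates, \<^const>\<open>snd\<close> the last one,
  and the norm and inner product of the product type are the Euclidean ones
  (see \<open>norm_Pair\<close>, \<open>inner_Pair\<close>).
\<close>

text \<open>Meaningful only for \<open>Y\<close> on the unit sphere with \<open>Y \<noteq> - v\<close>.\<close>

definition unembed :: "(real ^ 'd) \<times> real \<Rightarrow> (real ^ 'd) \<times> real \<Rightarrow> real \<Rightarrow> real ^ 'd" where
  "unembed Y v s = (2 * s) *\<^sub>R fst ((Y + v) /\<^sub>R (norm (Y + v))\<^sup>2)"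

definition cap :: "(real ^ 'd) \<times> real \<Rightarrow> real \<Rightarrow> ((real ^ 'd) \<times> real) set" where
  "cap p b = {x \<in> sphere 0 1. x \<bullet> p > b}"

text \<open>
  \<open>E\<close> is the open solid hyperellipsoid with center \<open>c\<close>, radius \<open>r1\<close> in the unit direction \<open>a1\<close>
  and radius \<open>r2\<close> in all directions orthogonal to \<open>a1\<close>.
\<close>

definition is_hyperellipsoid ::
    "(real ^ 'd) set \<Rightarrow> real ^ 'd \<Rightarrow> real ^ 'd \<Rightarrow> real \<Rightarrow> real \<Rightarrow> bool" where
  "is_hyperellipsoid E c a1 r1 r2 \<longleftrightarrow>
     norm a1 = 1 \<and> 0 < r1 \<and> 0 < r2 \<and>
     E = {y. ((y - c) \<bullet> a1)\<^sup>2 / r1\<^sup>2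
             + (norm (y - c - ((y - c) \<bullet> a1) *\<^sub>R a1))\<^sup>2 / r2\<^sup>2 < 1}"

end

theory Submission
  imports Defs
begin

text \<open>
  Before its last coordinate is dropped, the unembedding map is the inversion
  \<open>Y \<mapsto> 2 s (Y + v) / \<parallel>Y + v\<parallel>\<^sup>2\<close> with center \<open>- v\<close>, which is a stereographic projection of the
  sphere onto the hyperplane \<open>\<langle>Z, v\<rangle> = s\<close>. There the cap becomes a round ball with center
  \<open>s / (b + \<langle>p, v\<rangle>) (p + b v)\<close>, and dropping the last coordinate shrinks it by the factor
  \<open>\<bar>v\<^bsub>d+1\<^esub>\<bar>\<close> in the direction \<open>a\<^sub>1\<close> only. For the center, the choice of \<open>\<alpha>\<close> gives
  \<open>\<parallel>p - \<alpha> v\<parallel> = \<alpha> + b\<close>.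
\<close>

section \<open>Stereographic projection from \<open>- v\<close> and the image of a cap\<close>

definition stereo :: "'a::real_inner \<Rightarrow> real \<Rightarrow> 'a \<Rightarrow> 'a" where
  "stereo v s Y = (2 * s / (norm (Y + v))\<^sup>2) *\<^sub>R (Y + v)"

lemma unembed_eq_fst_stereo: "unembed Y v s = fst (stereo v s Y)"
  by (simp add: unembed_def stereo_def divide_inverse)

text \<open>Adding \<open>v\<close> back undoes the translation, and the inversion sending
  \<open>W\<close> to \<open>(2 * s / (norm W)\<^sup>2) *\<^sub>R W\<close> is an involution. With
  \<open>Z\<close> the lift h(x) of x, the argument of \<open>stereo v s\<close> is the embedding
  S(x, v, s).\<close>

lemma stereo_inverse:
  assumes "s \<noteq> 0" and "Z \<noteq> 0"
  shows "stereo v s ((2 * s / (norm Z)\<^sup>2) *\<^sub>R Z - v) = Z"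
proof -
  have "(norm ((2 * s / (norm Z)\<^sup>2) *\<^sub>R Z))\<^sup>2 = 4 * s\<^sup>2 / (norm Z)\<^sup>2"
    using assms by (simp add: power_mult_distrib power_divide power2_eq_square)
  then show ?thesis
    using assms by (simp add: stereo_def power2_eq_square)
qed

lemma norm_add_unit_sq:
  fixes Y v :: "'a::real_inner"
  assumes "norm Y = 1" and "norm v = 1"
  shows "(norm (Y + v))\<^sup>2 = 2 * (1 + Y \<bullet> v)"
  using assms by (simp add: power2_norm_eq_inner inner_simps norm_eq_1 inner_commute)

text \<open>The first summand is the squared radius of the ball in the hyperplane. Comparing with it
  leaves only \<open>(norm Z)\<^sup>2 < 2 * s * (Z \<bullet> p) / (b + p \<bullet> v)\<close>, which
  is the form that the cap inequality takes after inversion.\<close>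

lemma norm_diff_ball_center_sq:
  fixes Z v p :: "'a::real_inner"
  assumes "norm v = 1" and "norm p = 1" and "Z \<bullet> v = s" and "b + p \<bullet> v \<noteq> 0"
  shows "(norm (Z - (s / (b + p \<bullet> v)) *\<^sub>R (p + b *\<^sub>R v)))\<^sup>2
    = s\<^sup>2 * (1 - b\<^sup>2) / (b + p \<bullet> v)\<^sup>2 + (norm Z)\<^sup>2 - 2 * s * (Z \<bullet> p) / (b + p \<bullet> v)"
proof -
  define \<beta> where "\<beta> = b + p \<bullet> v"
  define q where "q = s / \<beta>"
  \<comment> \<open>Eliminating \<open>p \<bullet> v\<close> and \<open>s\<close> in favour of
    \<open>\<beta>\<close> and \<open>q\<close> turns the claim into a polynomial identity.\<close>
  have k: "p \<bullet> v = \<beta> - b" and s: "s = q * \<beta>"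
    using assms(4) by (simp_all add: \<beta>_def q_def)
  have v: "v \<bullet> v = 1" and p: "p \<bullet> p = 1"
    using assms(1,2) by (simp_all add: norm_eq_1)
  have "(norm (Z - q *\<^sub>R (p + b *\<^sub>R v)))\<^sup>2
    = (norm Z)\<^sup>2 - 2 * q * (Z \<bullet> p + b * s) + q\<^sup>2 * (1 + 2 * b * (p \<bullet> v) + b\<^sup>2)"
    using v p assms(3) unfolding power2_norm_eq_inner
    by (simp add: inner_simps inner_commute power2_eq_square algebra_simps)
  also have "\<dots> = q\<^sup>2 * (1 - b\<^sup>2) + (norm Z)\<^sup>2 - 2 * q * (Z \<bullet> p)"
    unfolding k s by (simp add: algebra_simps power2_eq_square)
  finally show ?thesis
    by (simp add: q_def \<beta>_def power_divide)
qed

text \<open>For \<open>Y = (2 * s / (norm Z)\<^sup>2) *\<^sub>R Z - v\<close>, the condition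
  \<open>Y \<bullet> p > b\<close> reads \<open>(b + p \<bullet> v) * (norm Z)\<^sup>2 < 2 * s * (Z
  \<bullet> p)\<close>. On the hyperplane this is the ball condition, as \<open>mem\<close>
  records.\<close>

lemma cap_image_stereo:
  fixes v p :: "'a::real_inner"
  assumes s: "s > 0" and v: "norm v = 1" and p: "norm p = 1" and \<beta>: "b + p \<bullet> v > 0"
  shows "stereo v s ` {Y \<in> sphere 0 1. Y \<bullet> p > b}
    = {Z. Z \<bullet> v = s \<and>
          (norm (Z - (s / (b + p \<bullet> v)) *\<^sub>R (p + b *\<^sub>R v)))\<^sup>2 < s\<^sup>2 * (1 - b\<^sup>2) / (b + p \<bullet> v)\<^sup>2}"
    (is "?L = ?R")
proof -
  have vv: "v \<bullet> v = 1"
    using v by (simp add: norm_eq_1)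
  have mem: "Z \<in> ?R \<longleftrightarrow> (b + p \<bullet> v) * (norm Z)\<^sup>2 < 2 * s * (Z \<bullet> p)" if "Z \<bullet> v = s" for Z
  proof -
    have "Z \<in> ?R \<longleftrightarrow> (norm Z)\<^sup>2 < 2 * s * (Z \<bullet> p) / (b + p \<bullet> v)"
      using norm_diff_ball_center_sq[OF v p that] \<beta> that by simp
    also have "\<dots> \<longleftrightarrow> (b + p \<bullet> v) * (norm Z)\<^sup>2 < 2 * s * (Z \<bullet> p)"
      using \<beta> by (simp add: pos_less_divide_eq mult.commute)
    finally show ?thesis .
  qed
  show ?thesis
  proof (intro equalityI subsetI)
    fix Z assume "Z \<in> ?L"
    then obtain Y where Y: "norm Y = 1" "Y \<bullet> p > b" and Z: "Z = stereo v s Y"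
      by auto
    \<comment> \<open>At \<open>- v\<close> the cap inequality would say
      \<open>- (p \<bullet> v) > b\<close>, against the positivity of
      \<open>b + p \<bullet> v\<close>.\<close>
    have "Y \<noteq> - v"
      using Y \<beta> by (auto simp: inner_commute)
    then have pos: "norm (Y + v) > 0"
      by (simp add: add_eq_0_iff2)
    have n: "(norm (Y + v))\<^sup>2 = 2 * (1 + Y \<bullet> v)"
      by (rule norm_add_unit_sq[OF Y(1) v])
    have "2 * (1 + Y \<bullet> v) > 0"
      unfolding n[symmetric] using pos by simp
    then have pos': "1 + Y \<bullet> v > 0"
      by simp
    have "Z \<bullet> v = 2 * s / (norm (Y + v))\<^sup>2 * (1 + Y \<bullet> v)"
      using vv by (simp add: Z stereo_def inner_simps add.commute)
    then have "Z \<bullet> v = s"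
      using pos' by (simp only: n) (simp add: divide_eq_eq)
    moreover have "(norm Z)\<^sup>2 = 4 * s\<^sup>2 / (norm (Y + v))\<^sup>2"
      using pos by (simp add: Z stereo_def power_mult_distrib power_divide power2_eq_square)
    moreover have "2 * s * (Z \<bullet> p) = 4 * s\<^sup>2 / (norm (Y + v))\<^sup>2 * (Y \<bullet> p + p \<bullet> v)"
      by (simp add: Z stereo_def inner_simps power2_eq_square inner_commute)
    \<comment> \<open>The cap inequality, shifted by \<open>p \<bullet> v\<close> and multiplied by
      \<open>(norm Z)\<^sup>2\<close>, gives the right-hand side of \<open>mem\<close>.\<close>
    moreover have "4 * s\<^sup>2 / (norm (Y + v))\<^sup>2 * (b + p \<bullet> v)
        < 4 * s\<^sup>2 / (norm (Y + v))\<^sup>2 * (Y \<bullet> p + p \<bullet> v)"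
      using Y(2) s pos by (intro mult_strict_left_mono) auto
    ultimately show "Z \<in> ?R"
      using mem[of Z] by (simp add: mult.commute)
  next
    fix Z assume R: "Z \<in> ?R"
    then have Zv: "Z \<bullet> v = s"
      by simp
    then have "Z \<noteq> 0"
      using s by auto
    then have pos: "(norm Z)\<^sup>2 > 0"
      by simp
    \<comment> \<open>The preimage is the embedding of \<open>Z\<close>. It is a unit vector because
      \<open>Z \<bullet> v = s\<close> makes the first two terms of \<open>Y \<bullet> Y\<close>
      cancel.\<close>
    define Y where "Y = (2 * s / (norm Z)\<^sup>2) *\<^sub>R Z - v"
    have "Y \<bullet> Y = (2 * s / (norm Z)\<^sup>2)\<^sup>2 * (norm Z)\<^sup>2 - 2 * (2 * s / (norm Z)\<^sup>2) * (Z \<bullet> v) + v \<bullet> v"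
      unfolding Y_def power2_norm_eq_inner
      by (simp add: inner_simps inner_commute power2_eq_square)
    also have "\<dots> = 1"
      using pos by (simp add: Zv vv field_simps power2_eq_square)
    finally have "norm Y = 1"
      by (simp add: norm_eq_1)
    moreover have "Y \<bullet> p > b"
      using R mem[OF Zv] pos
      by (simp add: Y_def inner_simps inner_commute field_simps)
    moreover have "stereo v s Y = Z"
      unfolding Y_def using s \<open>Z \<noteq> 0\<close> by (simp add: stereo_inverse)
    ultimately show "Z \<in> ?L"
      by force
  qed
qed

section \<open>Projecting a ball in a hyperplane along the last coordinate\<close>

lemma norm_orthogonal_part_sq:
  fixes e a :: "'a::real_inner"
  assumes "norm a = 1"
  shows "(norm (e - (e \<bullet> a) *\<^sub>R a))\<^sup>2 = (norm e)\<^sup>2 - (e \<bullet> a)\<^sup>2"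
  using assms unfolding power2_norm_eq_inner
  by (simp add: inner_simps norm_eq_1 inner_commute power2_eq_square)

text \<open>A point of the hyperplane is determined by its first coordinates, so the squared
  distance to \<open>C\<close> is a quadratic form in \<open>y - fst C\<close>. The tilt of the
  hyperplane divides the \<open>a\<close> component by \<open>\<bar>snd v\<bar>\<close> and leaves
  the directions orthogonal to \<open>a\<close> unchanged.\<close>

lemma fst_image_hyperplane_ball:
  fixes v C :: "'a::real_inner \<times> real"
  assumes v: "norm v = 1" "snd v \<noteq> 0" "fst v \<noteq> 0" and C: "C \<bullet> v = s" and r: "r > 0"
  defines "a \<equiv> fst v /\<^sub>R norm (fst v)"
  shows "fst ` {Z. Z \<bullet> v = s \<and> (norm (Z - C))\<^sup>2 < r\<^sup>2}
    = {y. ((y - fst C) \<bullet> a)\<^sup>2 / (r * \<bar>snd v\<bar>)\<^sup>2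
          + (norm (y - fst C - ((y - fst C) \<bullet> a) *\<^sub>R a))\<^sup>2 / r\<^sup>2 < 1}"
proof -
  have a: "norm a = 1"
    using v by (simp add: a_def)
  have fstv: "fst v = norm (fst v) *\<^sub>R a"
    using v by (simp add: a_def)
  have n: "(norm (fst v))\<^sup>2 = 1 - (snd v)\<^sup>2"
    using v(1) by (simp add: norm_prod_def eq_diff_eq)
  have dist: "(norm (Z - C))\<^sup>2 < r\<^sup>2 \<longleftrightarrow>
      ((fst Z - fst C) \<bullet> a)\<^sup>2 / (r * \<bar>snd v\<bar>)\<^sup>2
        + (norm (fst Z - fst C - ((fst Z - fst C) \<bullet> a) *\<^sub>R a))\<^sup>2 / r\<^sup>2 < 1"
    if "Z \<bullet> v = s" for Z
  proof -
    define e where "e = fst Z - fst C"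
    define t where "t = snd Z - snd C"
    \<comment> \<open>\<open>Z\<close> and \<open>C\<close> both lie in the hyperplane, so their
      difference is orthogonal to \<open>v\<close>; this expresses \<open>t\<close> through
      \<open>e \<bullet> a\<close>.\<close>
    have "e \<bullet> fst v + t * snd v = 0"
      using that C by (simp add: e_def t_def inner_prod_def inner_simps algebra_simps)
    then have "t * snd v = - (norm (fst v) * (e \<bullet> a))"
      by (subst (asm) fstv) (simp add: eq_neg_iff_add_eq_0 add.commute)
    then have "t\<^sup>2 * (snd v)\<^sup>2 = (1 - (snd v)\<^sup>2) * (e \<bullet> a)\<^sup>2"
      unfolding n[symmetric] by (metis power_mult_distrib power2_minus)
    then have t: "t\<^sup>2 = (e \<bullet> a)\<^sup>2 / (snd v)\<^sup>2 - (e \<bullet> a)\<^sup>2"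
      using v(2) by (simp add: field_simps)
    have "(norm (Z - C))\<^sup>2 = (norm e)\<^sup>2 + t\<^sup>2"
      by (simp add: norm_prod_def e_def t_def)
    \<comment> \<open>The negative term of \<open>t\<^sup>2\<close> is what turns
      \<open>(norm e)\<^sup>2\<close> into the squared norm of the part orthogonal to
      \<open>a\<close>.\<close>
    also have "\<dots> = (e \<bullet> a)\<^sup>2 / (snd v)\<^sup>2 + (norm (e - (e \<bullet> a) *\<^sub>R a))\<^sup>2"
      by (simp add: t norm_orthogonal_part_sq[OF a])
    finally have "(norm (Z - C))\<^sup>2 / r\<^sup>2
        = (e \<bullet> a)\<^sup>2 / (r * \<bar>snd v\<bar>)\<^sup>2 + (norm (e - (e \<bullet> a) *\<^sub>R a))\<^sup>2 / r\<^sup>2"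
      by (simp add: add_divide_distrib power_mult_distrib mult.commute)
    moreover have "(norm (Z - C))\<^sup>2 < r\<^sup>2 \<longleftrightarrow> (norm (Z - C))\<^sup>2 / r\<^sup>2 < 1"
      using r by simp
    ultimately show ?thesis
      by (simp add: e_def)
  qed
  \<comment> \<open>The witness is the lift h(y), available since \<open>snd v\<close> is
    nonzero.\<close>
  have lift: "\<exists>Z. Z \<bullet> v = s \<and> fst Z = y" for y
    using v(2) by (intro exI[of _ "(y, (s - y \<bullet> fst v) / snd v)"]) (simp add: inner_prod_def)
  show ?thesis
  proof (intro equalityI subsetI)
    fix y assume "y \<in> fst ` {Z. Z \<bullet> v = s \<and> (norm (Z - C))\<^sup>2 < r\<^sup>2}"
    then obtain Z where "Z \<bullet> v = s" "(norm (Z - C))\<^sup>2 < r\<^sup>2" "y = fst Z"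
      by blast
    with dist show "y \<in> {y. ((y - fst C) \<bullet> a)\<^sup>2 / (r * \<bar>snd v\<bar>)\<^sup>2
          + (norm (y - fst C - ((y - fst C) \<bullet> a) *\<^sub>R a))\<^sup>2 / r\<^sup>2 < 1}"
      by blast
  next
    fix y assume y: "y \<in> {y. ((y - fst C) \<bullet> a)\<^sup>2 / (r * \<bar>snd v\<bar>)\<^sup>2
          + (norm (y - fst C - ((y - fst C) \<bullet> a) *\<^sub>R a))\<^sup>2 / r\<^sup>2 < 1}"
    obtain Z where "Z \<bullet> v = s" "fst Z = y"
      using lift by blast
    with dist y show "y \<in> fst ` {Z. Z \<bullet> v = s \<and> (norm (Z - C))\<^sup>2 < r\<^sup>2}"
      by blast
  qed
qed

section \<open>The preimage of the center\<close>

text \<open>The equation for \<open>\<alpha>\<close> replaces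
  \<open>1 - 2 * \<alpha> * (p \<bullet> v)\<close> by \<open>2 * \<alpha> * b + b\<^sup>2\<close>,
  which completes the square \<open>(\<alpha> + b)\<^sup>2\<close>.\<close>

lemma norm_diff_alpha:
  fixes v p :: "'a::real_inner"
  assumes "norm v = 1" and "norm p = 1" and "0 \<le> b" and "0 \<le> \<alpha>"
    and "2 * \<alpha> * (b + p \<bullet> v) = 1 - b\<^sup>2"
  shows "norm (p - \<alpha> *\<^sub>R v) = \<alpha> + b"
proof -
  have "(norm (p - \<alpha> *\<^sub>R v))\<^sup>2 = 1 - 2 * \<alpha> * (p \<bullet> v) + \<alpha>\<^sup>2"
    using assms(1,2) unfolding power2_norm_eq_inner
    by (simp add: inner_simps norm_eq_1 inner_commute power2_eq_square)
  also have "\<dots> = (\<alpha> + b)\<^sup>2"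
    using assms(5) by (simp add: power2_eq_square algebra_simps)
  finally show ?thesis
    using assms(3,4) by (simp add: power2_eq_iff_nonneg)
qed

text \<open>Since \<open>w\<close> has denominator \<open>\<alpha> + b\<close>, adding
  \<open>v\<close> cancels \<open>\<alpha>\<close> and leaves a positive multiple of
  \<open>p + b *\<^sub>R v\<close>. Inversion keeps this direction, so only the scalar factor has to
  be computed.\<close>

lemma stereo_center:
  fixes v p :: "'a::real_inner"
  assumes v: "norm v = 1" and p: "norm p = 1" and b: "0 \<le> b" and \<alpha>: "0 < \<alpha>"
    and \<beta>: "b + p \<bullet> v > 0" and eq: "2 * \<alpha> * (b + p \<bullet> v) = 1 - b\<^sup>2"
  defines "w \<equiv> (p - \<alpha> *\<^sub>R v) /\<^sub>R norm (p - \<alpha> *\<^sub>R v)"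
  shows "norm w = 1" and "w \<noteq> - v"
    and "stereo v s w = (s / (b + p \<bullet> v)) *\<^sub>R (p + b *\<^sub>R v)"
proof -
  have n: "norm (p - \<alpha> *\<^sub>R v) = \<alpha> + b"
    using norm_diff_alpha[OF v p b _ eq] \<alpha> by simp
  then show w: "norm w = 1"
    using \<alpha> b by (simp add: w_def)
  have wv: "w \<bullet> v = (p \<bullet> v - \<alpha>) / (\<alpha> + b)"
    using v by (simp add: w_def n inner_simps norm_eq_1 divide_inverse)
  have "(norm (w + v))\<^sup>2 = 2 * (1 + w \<bullet> v)"
    using w v by (rule norm_add_unit_sq)
  also have "\<dots> = 2 * (b + p \<bullet> v) / (\<alpha> + b)"
    using \<alpha> b by (simp add: wv field_simps)
  finally have sq: "(norm (w + v))\<^sup>2 = 2 * (b + p \<bullet> v) / (\<alpha> + b)" .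
  then show "w \<noteq> - v"
    using \<alpha> b \<beta> by auto
  have "w + v = inverse (\<alpha> + b) *\<^sub>R (p - \<alpha> *\<^sub>R v + (\<alpha> + b) *\<^sub>R v)"
    using \<alpha> b by (simp add: w_def n scaleR_add_right)
  also have "\<dots> = inverse (\<alpha> + b) *\<^sub>R (p + b *\<^sub>R v)"
    by (simp add: scaleR_add_left)
  finally have "stereo v s w
      = (2 * s / (2 * (b + p \<bullet> v) / (\<alpha> + b))) *\<^sub>R inverse (\<alpha> + b) *\<^sub>R (p + b *\<^sub>R v)"
    unfolding stereo_def sq by (rule arg_cong)
  also have "\<dots> = (s / (b + p \<bullet> v)) *\<^sub>R (p + b *\<^sub>R v)"
  proof -
    have "2 * s / (2 * (b + p \<bullet> v) / (\<alpha> + b)) * inverse (\<alpha> + b) = s / (b + p \<bullet> v)"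
      using \<alpha> b \<beta> by (simp only: divide_inverse inverse_mult_distrib inverse_inverse_eq) simp
    then show ?thesis
      by (simp only: scaleR_scaleR)
  qed
  finally show "stereo v s w = (s / (b + p \<bullet> v)) *\<^sub>R (p + b *\<^sub>R v)" .
qed

section \<open>From the ball in the hyperplane to the hyperellipsoid and the order of its
  radii\<close>

theorem theorem5:
  fixes s b :: real and v p :: "(real ^ 'd) \<times> real"
  assumes "s > 0"
    and "norm v = 1" and "snd v \<noteq> 0" and "v \<noteq> (0, 1)" and "v \<noteq> (0, - 1)"
    and "norm p = 1" and "0 \<le> b" and "b < 1" and "b + p \<bullet> v > 0"
  shows "let \<alpha> = (1 - b\<^sup>2) / (2 * (b + p \<bullet> v));
             w = (p - \<alpha> *\<^sub>R v) /\<^sub>R norm (p - \<alpha> *\<^sub>R v);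
             c = unembed w v s;
             r1 = s * sqrt ((1 - b\<^sup>2) * (snd v)\<^sup>2 / (b + p \<bullet> v)\<^sup>2);
             a1 = fst v /\<^sub>R norm (fst v);
             r2 = s * sqrt ((1 - b\<^sup>2) / (b + p \<bullet> v)\<^sup>2)
         in cap p b \<subseteq> sphere 0 1 - {- v}
          \<and> w \<in> sphere 0 1 - {- v}
          \<and> is_hyperellipsoid ((\<lambda>Y. unembed Y v s) ` cap p b) c a1 r1 r2
          \<and> r1 = s * sqrt ((1 - b\<^sup>2) / (b + p \<bullet> v)\<^sup>2) * \<bar>snd v\<bar>
          \<and> r1 < r2"
proof -
  define \<beta> where "\<beta> = b + p \<bullet> v"
  define \<alpha> where "\<alpha> = (1 - b\<^sup>2) / (2 * \<beta>)"
  define w where "w = (p - \<alpha> *\<^sub>R v) /\<^sub>R norm (p - \<alpha> *\<^sub>R v)"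
  define C where "C = (s / \<beta>) *\<^sub>R (p + b *\<^sub>R v)"
  \<comment> \<open>The radius of the ball in the hyperplane. It survives the projection as
    \<open>r2\<close>, and \<open>r1\<close> is \<open>r * \<bar>snd v\<bar>\<close>.\<close>
  define r where "r = s * sqrt ((1 - b\<^sup>2) / \<beta>\<^sup>2)"
  note s = assms(1) and v = assms(2) and v0 = assms(3) and p = assms(6) and b = assms(7,8)
  have \<beta>: "\<beta> > 0"
    using assms(9) by (simp add: \<beta>_def)
  have b2: "1 - b\<^sup>2 > 0"
    using b by (simp add: power_less_one_iff abs_square_less_1)
  have \<alpha>: "\<alpha> > 0" "2 * \<alpha> * \<beta> = 1 - b\<^sup>2"
    using \<beta> b2 by (simp_all add: \<alpha>_def)
  note center = stereo_center[OF v p b(1) \<alpha>(1) assms(9) \<alpha>(2)[unfolded \<beta>_def], folded w_def]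
  have c: "unembed w v s = fst C"
    by (simp add: unembed_eq_fst_stereo center(3) C_def \<beta>_def)
  have r: "r > 0"
    using s b2 \<beta> by (simp add: r_def)
  have r2: "r\<^sup>2 = s\<^sup>2 * (1 - b\<^sup>2) / \<beta>\<^sup>2"
    using b2 by (simp add: r_def power_mult_distrib)
  have CV: "C \<bullet> v = s"
    using v \<beta> by (simp add: C_def \<beta>_def inner_simps norm_eq_1 add.commute)
  \<comment> \<open>Excluding the two poles makes \<open>a1\<close> a unit vector and gives
    \<open>\<bar>snd v\<bar> < 1\<close> below, hence the strict \<open>r1 < r2\<close>.\<close>
  have fv: "fst v \<noteq> 0"
  proof
    assume "fst v = 0"
    then have "v = (0, snd v)" and "\<bar>snd v\<bar> = 1"
      using v by (simp_all add: prod_eq_iff norm_prod_def)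
    with assms(4,5) show False
      by (cases "snd v \<ge> 0") auto
  qed
  have "(norm (fst v))\<^sup>2 + (snd v)\<^sup>2 = 1"
    using v by (simp add: norm_prod_def)
  then have "(snd v)\<^sup>2 < 1"
    using fv by (metis add.commute less_add_same_cancel1 zero_less_norm_iff zero_less_power)
  then have v1: "\<bar>snd v\<bar> < 1"
    by (simp add: abs_square_less_1)
  have r1: "s * sqrt ((1 - b\<^sup>2) * (snd v)\<^sup>2 / \<beta>\<^sup>2) = r * \<bar>snd v\<bar>"
    by (simp add: r_def real_sqrt_mult real_sqrt_divide)
  have "(\<lambda>Y. unembed Y v s) ` cap p b = fst ` stereo v s ` {Y \<in> sphere 0 1. Y \<bullet> p > b}"
    by (simp add: unembed_eq_fst_stereo cap_def image_image)
  also have "\<dots> = fst ` {Z. Z \<bullet> v = s \<and> (norm (Z - C))\<^sup>2 < r\<^sup>2}"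
    unfolding cap_image_stereo[OF s v p assms(9)] C_def r2 \<beta>_def by (rule refl)
  finally have "is_hyperellipsoid ((\<lambda>Y. unembed Y v s) ` cap p b) (fst C)
      (fst v /\<^sub>R norm (fst v)) (r * \<bar>snd v\<bar>) r"
    using fst_image_hyperplane_ball[OF v v0 fv CV r] fv v0 r
    by (simp add: is_hyperellipsoid_def)
  moreover have "cap p b \<subseteq> sphere 0 1 - {- v}"
    using assms(9) by (auto simp: cap_def inner_commute)
  moreover have "r * \<bar>snd v\<bar> < r"
    using r v1 by simp
  ultimately show ?thesis
    using center(1,2)
    unfolding Let_def \<beta>_def[symmetric] \<alpha>_def[symmetric] w_def[symmetric] r1 c r_def[symmetric]
    by simp
qed

end
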